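(* Assume: (1) $\nabla \mathbf{R}_H$ is Lipschitz continuous on $\mathbb{R}^d$ with constant $L_H$; (2) $\mathbf{R}_H$ is bounded below on $\mathbb{R}^d$, with infimum $\mathbf{R}_\star=\inf_x\mathbf{R}_H(x)$; (3) $\mathbf{R}_H$ is strongly convex with constant $c_H>0$; (4) there are constants $W_{ML}\ge 0$ and $W_{V,ML}\ge 0$ such that for all $x\in\mathbb{R}^d$ and all iterations $k$ $$\mathbb{E}\big[\|\nabla\mathbf{\hat R}_{ML}^{(k)}(x)\|_2^2\big]-\big\|\mathbb{E}[\nabla\mathbf{\hat R}_{ML}^{(k)}(x)]\big\|_2^2\le W_{ML}+W_{V,ML}\|\nabla\mathbf{R}_H(x)\|_2^2 .$$ Let $x_{k+1}=x_k-\alpha_k\nabla\mathbf{\hat R}_{ML}^{(k)}(x_k)$ for $k\ge 1$, with learning rate $$\alpha_k=\frac{\beta}{\gamma+k}\le\frac{1}{L_H(W_{V,ML}+1)}\quad\text{for all }k\ge1,$$ for constants $\beta>1/c_H$ and $\gamma>0$. Then for all $k\ge1$ $$\mathbb{E}\big[\mathbf{R}_H(x_k)-\mathbf{R}_\star\big]\le\frac{\nu}{\gamma+k},\qquad \nu=\max\left\{\frac{\beta^2L_HW_{ML}}{2(\beta c_H-1)},\ (\gamma+1)\big(\mathbf{R}_H(x_1)-\mathbf{R}_\star\big)\right\}.$$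
   Context: Setting. $\xi$ is a random variable with sample space $\Xi$; $J_H(x,\xi)$ and $J_L(x,\xi)$ are a high-fidelity and a low-fidelity random objective, $x\in\mathbb{R}^d$. $\mathbf{R}$ is a risk metric (a statistic such as the expectation) mapping a random variable to a scalar, and $\mathbf{R}_H(x)=\mathbf{R}[J_H(x,\xi)]$, $\mathbf{R}_L(x)=\mathbf{R}[J_L(x,\xi)]$. $\mathbf{\hat R}_H^n(x)$, $\mathbf{\hat R}_L^n(x)$ denote sampling-based estimators of $\mathbf{R}_H(x)$, $\mathbf{R}_L(x)$ using $n$ i.i.d. samples of $\xi$; $\nabla$ denotes the gradient in $x$. The gradient estimators are unbiased: $\mathbb{E}[\nabla\mathbf{\hat R}_H^n(x)]=\nabla\mathbf{R}_H(x)$ and $\mathbb{E}[\nabla\mathbf{\hat R}_L^n(x)]=\nabla\mathbf{R}_L(x)$ for all $x$ and $n$. For sample sizes $M>N$, the multilevel Monte Carlo (MLMC) gradient estimator is $$\nabla\mathbf{\hat R}_{ML}^{(k)}(x)=\nabla\mathbf{\hat R}_H^N(x)-\big(\nabla\mathbf{\hat R}_L^N(x)-\nabla\mathbf{\hat R}_L^M(x)\big),$$ where $\nabla\mathbf{\hat R}_H^N$ and $\nabla\mathbf{\hat R}_L^N$ use the same $N$ samples and $\nabla\mathbf{\hat R}_L^M$ uses $M$ samples independent of these. The superscript $(k)$ indicates that at each iteration $k$ a new set of samples, independent of those of all earlier iterations, is used. $x_1$ is a given (deterministic) starting point. Strong convexity of $f$ with constant $c>0$ means $f(x)\ge f(x')+\nabla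 f(x')^\top(x-x')+\frac c2\|x-x'\|_2^2$ for all $x,x'\in\mathbb{R}^d$. *)

theory Defs
  imports "HOL-Probability.Probability"
begin

text \<open>The value is unspecified at points where \<open>f\<close> is not differentiable.\<close>

definition grad :: "('a::real_inner \<Rightarrow> real) \<Rightarrow> 'a \<Rightarrow> 'a" where
  "grad f x = (THE g. GDERIV f x :> g)"

lemma grad_eq:
  assumes "GDERIV f x :> g"
  shows "grad f x = g"
  unfolding grad_def
proof (rule the_equality)
  fix g' assume "GDERIV f x :> g'"
  from this assms have "(\<lambda>h. h \<bullet> g') = (\<lambda>h. h \<bullet> g)"
    unfolding gderiv_def by (rule has_derivative_unique)
  then have "\<forall>h. h \<bullet> g' = h \<bullet> g"
    by (auto dest: fun_cong)
  then show "g' = g"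
    by (simp only: vector_eq_ldot)
qed (fact assms)

lemma GDERIV_grad:
  fixes f :: "'a::euclidean_space \<Rightarrow> real"
  assumes "f differentiable (at x)"
  shows "GDERIV f x :> grad f x"
proof -
  obtain D where D: "(f has_derivative D) (at x)"
    using assms unfolding differentiable_def by blast
  interpret linear D
    using D by (rule has_derivative_linear)
  have "D = (\<lambda>h. h \<bullet> adjoint D 1)"
    using adjoint_works[OF linear_axioms, of _ 1] by (simp add: fun_eq_iff)
  with D have "GDERIV f x :> adjoint D 1"
    unfolding gderiv_def by (rule back_subst[where P = "\<lambda>D. (f has_derivative D) (at x)"])
  with grad_eq[OF this] show ?thesis
    by simp
qed

definition strongly_convex :: "real \<Rightarrow> ('a::real_inner \<Rightarrow> real) \<Rightarrow> bool" where
  "strongly_convex c f \<longleftrightarrow>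
     (\<forall>x x'. f x \<ge> f x' + grad f x' \<bullet> (x - x') + c / 2 * (norm (x - x'))\<^sup>2)"

text \<open>
  A family of sampling-based estimators \<open>R\<close> is a function of the sample size \<open>n\<close>, the point \<open>x\<close>
  and the sample \<open>(s 0, \<dots>, s (n - 1))\<close>, which is an element of \<open>PiM {..<n} (\<lambda>_. D)\<close>, i.e.
  \<open>n\<close> i.i.d. draws from the law \<open>D\<close>.  The estimator is only required to be differentiable
  in \<open>x\<close> almost surely.  Joint measurability of its gradient is what makes the gradient
  at a random point a random variable.
\<close>

definition gradient_estimator ::
  "'s measure \<Rightarrow> (nat \<Rightarrow> 'a::euclidean_space \<Rightarrow> (nat \<Rightarrow> 's) \<Rightarrow> real) \<Rightarrow> bool" where
  "gradient_estimator D R \<longleftrightarrow>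
     (\<forall>n\<ge>1.
        (\<forall>x. (\<lambda>s. R n x s) \<in> borel_measurable (PiM {..<n} (\<lambda>_. D))) \<and>
        (\<forall>x. AE s in PiM {..<n} (\<lambda>_. D). (\<lambda>y. R n y s) differentiable (at x)) \<and>
        (\<lambda>(x, s). grad (\<lambda>y. R n y s) x) \<in> borel_measurable (borel \<Otimes>\<^sub>M PiM {..<n} (\<lambda>_. D)))"

definition unbiased_gradient ::
  "'s measure \<Rightarrow> (nat \<Rightarrow> 'a::euclidean_space \<Rightarrow> (nat \<Rightarrow> 's) \<Rightarrow> real) \<Rightarrow> ('a \<Rightarrow> real) \<Rightarrow> bool" where
  "unbiased_gradient D R f \<longleftrightarrow>
     (\<forall>n\<ge>1. \<forall>x.
        integrable (PiM {..<n} (\<lambda>_. D)) (\<lambda>s. grad (\<lambda>y. R n y s) x) \<and>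
        (\<integral>s. grad (\<lambda>y. R n y s) x \<partial>(PiM {..<n} (\<lambda>_. D))) = grad f x)"

text \<open>
  \<open>Z j\<close>, \<open>j < N + M\<close>, are the draws of one iteration: the first \<open>N\<close> are shared by the
  high- and the low-fidelity estimator, the remaining \<open>M\<close> are used by the second low-fidelity one.
\<close>

definition ml_gradient ::
  "(nat \<Rightarrow> 'a::euclidean_space \<Rightarrow> (nat \<Rightarrow> 's) \<Rightarrow> real) \<Rightarrow> (nat \<Rightarrow> 'a \<Rightarrow> (nat \<Rightarrow> 's) \<Rightarrow> real) \<Rightarrow>
   nat \<Rightarrow> nat \<Rightarrow> (nat \<Rightarrow> 's) \<Rightarrow> 'a \<Rightarrow> 'a" where
  "ml_gradient RH RL N M Z x =
     (let s = restrict Z {..<N}; t = (\<lambda>j\<in>{..<M}. Z (N + j)) in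
      grad (\<lambda>y. RH N y s) x - (grad (\<lambda>y. RL N y s) x - grad (\<lambda>y. RL M y t) x))"

end

theory Submission
  imports Defs
begin

text \<open>
  The iterate \<open>x k\<close> depends only on the samples of the iterations before \<open>k\<close>, so it is independent
  of those of iteration \<open>k\<close>, and the mean and variance of the estimator at deterministic points
  carry over to \<open>x k\<close>. With the descent lemma for \<open>L\<close>-smooth functions and step sizes
  \<open>\<alpha> \<le> 1 / (L (V + 1))\<close> this gives
  \<open>E f (x (k + 1)) \<le> E f (x k) - \<alpha> / 2 E |grad f (x k)|^2 + \<alpha>^2 L W / 2\<close>.
  Strong convexity bounds \<open>|grad f|^2\<close> below by \<open>2 c (f - inf f)\<close>, and the resulting linear
  recursion for the expected gap is solved by induction; \<open>\<beta> c > 1\<close> is what makes \<open>\<nu> / (\<gamma> + k)\<close>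
  a supersolution.
\<close>

section \<open>Smooth and strongly convex functions\<close>

text \<open>Along the segment from \<open>x\<close> to \<open>y\<close>, \<open>\<phi>\<close> is
  \<open>f\<close> minus the linear and quadratic terms of the bound. By Cauchy-Schwarz and the
  Lipschitz condition its derivative is nonpositive on the unit interval; comparing the endpoints
  gives the claim.\<close>

lemma descent_lemma:
  fixes f :: "'a::euclidean_space \<Rightarrow> real"
  assumes diff: "\<And>y. f differentiable (at y)" and Lip: "L-lipschitz_on UNIV (grad f)"
  shows "f y \<le> f x + grad f x \<bullet> (y - x) + L / 2 * (norm (y - x))\<^sup>2"
proof -
  define d where "d = y - x"
  define \<phi> where "\<phi> t = f (x + t *\<^sub>R d) - t * (grad f x \<bullet> d) - L / 2 * t\<^sup>2 * (norm d)\<^sup>2" for t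
  have "\<phi> 0 \<ge> \<phi> 1"
  proof (rule DERIV_nonpos_imp_nonincreasing[where f = \<phi>])
    fix t :: real assume t: "0 \<le> t" "t \<le> 1"
    let ?D = "grad f (x + t *\<^sub>R d) \<bullet> d - grad f x \<bullet> d - L * t * (norm d)\<^sup>2"
    have "(f has_derivative (\<lambda>h. h \<bullet> grad f (x + t *\<^sub>R d))) (at (x + t *\<^sub>R d))"
      using GDERIV_grad[OF diff] unfolding gderiv_def .
    moreover have "((\<lambda>t. x + t *\<^sub>R d) has_derivative (\<lambda>s. s *\<^sub>R d)) (at t)"
      by (auto intro!: derivative_eq_intros)
    ultimately have "((\<lambda>t. f (x + t *\<^sub>R d)) has_derivative (\<lambda>s. (s *\<^sub>R d) \<bullet> grad f (x + t *\<^sub>R d))) (at t)"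
      by (rule has_derivative_compose[rotated])
    then have "((\<lambda>t. f (x + t *\<^sub>R d)) has_real_derivative (grad f (x + t *\<^sub>R d) \<bullet> d)) (at t)"
      by (simp add: has_field_derivative_def inner_commute mult_commute_abs)
    then have "(\<phi> has_real_derivative ?D) (at t)"
      unfolding \<phi>_def by (auto intro!: derivative_eq_intros)
    moreover have "?D \<le> 0"
    proof -
      have "grad f (x + t *\<^sub>R d) \<bullet> d - grad f x \<bullet> d \<le> norm (grad f (x + t *\<^sub>R d) - grad f x) * norm d"
        by (simp add: inner_diff_left[symmetric] norm_cauchy_schwarz)
      also have "\<dots> \<le> L * (t * norm d) * norm d"
        using lipschitz_onD[OF Lip, of "x + t *\<^sub>R d" x] t by (intro mult_right_mono) (simp_all add: dist_norm)
      finally show ?thesis by (simp add: power2_eq_square mult.assoc)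
    qed
    ultimately show "\<exists>D. DERIV \<phi> t :> D \<and> D \<le> 0" by blast
  qed simp
  then show ?thesis by (simp add: \<phi>_def d_def algebra_simps)
qed

text \<open>A gradient step of size \<open>1 / L\<close> lowers \<open>f\<close> by at least
  \<open>|grad f x|^2 / (2 L)\<close>, yet cannot fall below \<open>m\<close>. This turns
  integrability of \<open>f\<close> at a random point into square integrability of the gradient
  there.\<close>

lemma grad_norm_le_gap:
  fixes f :: "'a::euclidean_space \<Rightarrow> real"
  assumes "\<And>y. f differentiable (at y)" "L-lipschitz_on UNIV (grad f)" "L > 0"
    and lower: "\<And>y. m \<le> f y"
  shows "(norm (grad f x))\<^sup>2 \<le> 2 * L * (f x - m)"
proof -
  have "m \<le> f (x - (1 / L) *\<^sub>R grad f x)" by (rule lower)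
  also have "\<dots> \<le> f x - (norm (grad f x))\<^sup>2 / L + L / 2 * ((norm (grad f x))\<^sup>2 / L\<^sup>2)"
    using descent_lemma[OF assms(1,2), of "x - (1 / L) *\<^sub>R grad f x" x]
    by (simp add: power2_norm_eq_inner power_divide)
  also have "\<dots> = f x - (norm (grad f x))\<^sup>2 / (2 * L)"
    using \<open>L > 0\<close> by (simp add: field_simps power2_eq_square)
  finally show ?thesis using \<open>L > 0\<close> by (simp add: field_simps)
qed

text \<open>The Polyak-Lojasiewicz inequality. Completing the square shows that the quadratic
  minorant at \<open>x\<close> is smallest at displacement \<open>-(1 / c) grad f x\<close>, and its
  minimum bounds the infimum of \<open>f\<close> from below.\<close>

lemma strongly_convex_gap_le:
  fixes f :: "'a::euclidean_space \<Rightarrow> real"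
  assumes "strongly_convex c f" "c > 0"
  shows "2 * c * (f x - (INF y. f y)) \<le> (norm (grad f x))\<^sup>2"
proof -
  have "f x - (norm (grad f x))\<^sup>2 / (2 * c) \<le> f y" for y
  proof -
    let ?g = "grad f x"
    have "0 \<le> c / 2 * (norm (d + (1 / c) *\<^sub>R g))\<^sup>2" for d g :: 'a
      using \<open>c > 0\<close> by simp
    also have "c / 2 * (norm (d + (1 / c) *\<^sub>R g))\<^sup>2 = c / 2 * (norm d)\<^sup>2 + g \<bullet> d + (norm g)\<^sup>2 / (2 * c)" for d g :: 'a
      using \<open>c > 0\<close> unfolding power2_norm_eq_inner
      by (simp add: inner_add_left inner_add_right inner_commute field_simps)
    finally have "0 \<le> c / 2 * (norm (y - x))\<^sup>2 + ?g \<bullet> (y - x) + (norm ?g)\<^sup>2 / (2 * c)" .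
    then show ?thesis
      using assms(1) unfolding strongly_convex_def by (smt (verit))
  qed
  then have "f x - (norm (grad f x))\<^sup>2 / (2 * c) \<le> (INF y. f y)"
    by (intro cINF_greatest) auto
  then show ?thesis using \<open>c > 0\<close> by (simp add: field_simps)
qed

text \<open>The quadratic minorant and majorant at \<open>0\<close> are compared at a basis vector,
  which has norm 1. Together with the step-size bound this keeps the contraction factor of the final
  recursion nonnegative.\<close>

lemma strong_convexity_le_smoothness:
  fixes f :: "'a::euclidean_space \<Rightarrow> real"
  assumes "\<And>y. f differentiable (at y)" "L-lipschitz_on UNIV (grad f)" "strongly_convex c f"
  shows "c \<le> L"
proof -
  obtain b :: 'a where b: "b \<in> Basis" using nonempty_Basis by blast
  have "f b \<ge> f 0 + grad f 0 \<bullet> (b - 0) + c / 2 * (norm (b - 0))\<^sup>2"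
    using assms(3) unfolding strongly_convex_def by blast
  with descent_lemma[OF assms(1,2), of b 0] b show ?thesis by simp
qed

lemma borel_measurable_grad_lipschitz:
  assumes "L-lipschitz_on UNIV (grad f)"
  shows "grad f \<in> borel_measurable borel"
  using lipschitz_on_continuous_on[OF assms] by (rule borel_measurable_continuous_onI)

section \<open>Integrating out an independent variable\<close>

text \<open>
  Independence of \<open>X\<close> and \<open>U\<close> is stated as a product law, since \<open>indep_var\<close> forces both variables
  to have the same type.
\<close>

context prob_space
begin

text \<open>Tonelli for the product law. It presupposes no integrability, so it can serve to
  establish square integrability of the estimator at a random point.\<close>

lemma nn_integral_indep_freeze:
  assumes X: "random_variable S X" and U: "random_variable T U"
    and joint: "distr M (S \<Otimes>\<^sub>M T) (\<lambda>\<omega>. (X \<omega>, U \<omega>)) = distr M S X \<Otimes>\<^sub>M distr M T U"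
    and F: "F \<in> borel_measurable (S \<Otimes>\<^sub>M T)"
  shows "(\<integral>\<^sup>+\<omega>. F (X \<omega>, U \<omega>) \<partial>M) = (\<integral>\<^sup>+\<omega>. (\<integral>\<^sup>+\<omega>'. F (X \<omega>, U \<omega>') \<partial>M) \<partial>M)"
proof -
  note [measurable] = X U F
  interpret T: prob_space "distr M T U" by (rule prob_space_distr) simp
  have "(\<integral>\<^sup>+\<omega>. F (X \<omega>, U \<omega>) \<partial>M) = integral\<^sup>N (distr M (S \<Otimes>\<^sub>M T) (\<lambda>\<omega>. (X \<omega>, U \<omega>))) F"
    by (simp add: nn_integral_distr)
  also have "\<dots> = integral\<^sup>N (distr M S X \<Otimes>\<^sub>M distr M T U) F"
    by (simp add: joint)
  also have "\<dots> = (\<integral>\<^sup>+y. (\<integral>\<^sup>+u. F (y, u) \<partial>distr M T U) \<partial>distr M S X)"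
    by (rule T.nn_integral_fst[symmetric]) simp
  also have "\<dots> = (\<integral>\<^sup>+\<omega>. (\<integral>\<^sup>+u. F (X \<omega>, u) \<partial>distr M T U) \<partial>M)"
    by (rule nn_integral_distr) (auto intro!: T.borel_measurable_nn_integral_fst)
  also have "\<dots> = (\<integral>\<^sup>+\<omega>. (\<integral>\<^sup>+\<omega>'. F (X \<omega>, U \<omega>') \<partial>M) \<partial>M)"
    by (intro nn_integral_cong nn_integral_distr) (auto dest: measurable_space[OF X])
  finally show ?thesis .
qed

text \<open>The Fubini counterpart for signed integrands, meant for the inner product of true and
  estimated gradient once that is known to be integrable.\<close>

lemma integral_indep_freeze:
  fixes F :: "_ \<Rightarrow> real"
  assumes X: "random_variable S X" and U: "random_variable T U"
    and joint: "distr M (S \<Otimes>\<^sub>M T) (\<lambda>\<omega>. (X \<omega>, U \<omega>)) = distr M S X \<Otimes>\<^sub>M distr M T U"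
    and F: "F \<in> borel_measurable (S \<Otimes>\<^sub>M T)"
    and int: "integrable M (\<lambda>\<omega>. F (X \<omega>, U \<omega>))"
  shows "(\<integral>\<omega>. F (X \<omega>, U \<omega>) \<partial>M) = (\<integral>\<omega>. (\<integral>\<omega>'. F (X \<omega>, U \<omega>') \<partial>M) \<partial>M)"
proof -
  note [measurable] = X U F
  interpret S: prob_space "distr M S X" by (rule prob_space_distr) simp
  interpret T: prob_space "distr M T U" by (rule prob_space_distr) simp
  interpret ST: pair_sigma_finite "distr M S X" "distr M T U" ..
  have "integrable (distr M S X \<Otimes>\<^sub>M distr M T U) F"
    unfolding joint[symmetric] using int by (subst integrable_distr_eq) simp_all
  from ST.integral_fst'[OF this]
  have "(\<integral>y. (\<integral>u. F (y, u) \<partial>distr M T U) \<partial>distr M S X) = integral\<^sup>L (distr M S X \<Otimes>\<^sub>M distr M T U) F" .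
  also have "\<dots> = (\<integral>\<omega>. F (X \<omega>, U \<omega>) \<partial>M)"
    unfolding joint[symmetric] by (rule integral_distr) simp_all
  also have "(\<integral>y. (\<integral>u. F (y, u) \<partial>distr M T U) \<partial>distr M S X)
      = (\<integral>\<omega>. (\<integral>u. F (X \<omega>, u) \<partial>distr M T U) \<partial>M)"
    by (rule integral_distr) (auto intro!: T.borel_measurable_lebesgue_integral)
  also have "\<dots> = (\<integral>\<omega>. (\<integral>\<omega>'. F (X \<omega>, U \<omega>') \<partial>M) \<partial>M)"
    by (intro Bochner_Integration.integral_cong refl integral_distr) (auto dest: measurable_space[OF X])
  finally show ?thesis by simp
qed

text \<open>
  The noise bound is required only at deterministic points; independence of \<open>X\<close> and \<open>U\<close>
  transfers it to the random point \<open>X\<close>.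
\<close>

lemma sgd_step:
  fixes f :: "'b::euclidean_space \<Rightarrow> real" and X :: "'a \<Rightarrow> 'b" and U :: "'a \<Rightarrow> 'u" and h :: "'b \<Rightarrow> 'u \<Rightarrow> 'b"
  assumes diff: "\<And>y. f differentiable (at y)" and Lip: "L-lipschitz_on UNIV (grad f)" "L > 0"
    and lower: "\<And>y. m \<le> f y"
    and X: "random_variable borel X" and U: "random_variable T U"
    and joint: "distr M (borel \<Otimes>\<^sub>M T) (\<lambda>\<omega>. (X \<omega>, U \<omega>)) = distr M borel X \<Otimes>\<^sub>M distr M T U"
    and h: "(\<lambda>(y, u). h y u) \<in> borel_measurable (borel \<Otimes>\<^sub>M T)"
    and h_int: "\<And>y. integrable M (\<lambda>\<omega>. h y (U \<omega>))"
    and h_mean: "\<And>y. (\<integral>\<omega>. h y (U \<omega>) \<partial>M) = grad f y"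
    and h_sq: "\<And>y. integrable M (\<lambda>\<omega>. (norm (h y (U \<omega>)))\<^sup>2)"
    and h_var: "\<And>y. (\<integral>\<omega>. (norm (h y (U \<omega>)))\<^sup>2 \<partial>M) - (norm (\<integral>\<omega>. h y (U \<omega>) \<partial>M))\<^sup>2
      \<le> W + V * (norm (grad f y))\<^sup>2"
    and a: "0 \<le> a" "a * L * (V + 1) \<le> 1"
    and WV: "0 \<le> W" "0 \<le> V"
    and int: "integrable M (\<lambda>\<omega>. f (X \<omega>))"
  shows "integrable M (\<lambda>\<omega>. f (X \<omega> - a *\<^sub>R h (X \<omega>) (U \<omega>)))" (is ?int)
    and "integrable M (\<lambda>\<omega>. (norm (grad f (X \<omega>)))\<^sup>2)"
    and "(\<integral>\<omega>. f (X \<omega> - a *\<^sub>R h (X \<omega>) (U \<omega>)) \<partial>M)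
      \<le> (\<integral>\<omega>. f (X \<omega>) \<partial>M) - a / 2 * (\<integral>\<omega>. (norm (grad f (X \<omega>)))\<^sup>2 \<partial>M) + a\<^sup>2 * L * W / 2" (is ?bound)
proof -
  note [measurable] = X U h
  have [measurable]: "f \<in> borel_measurable borel"
    using diff by (intro borel_measurable_continuous_onI)
      (auto simp: continuous_on_eq_continuous_at differentiable_imp_continuous_within)
  have [measurable]: "grad f \<in> borel_measurable borel"
    using Lip(1) by (rule borel_measurable_grad_lipschitz)
  let ?g = "\<lambda>\<omega>. grad f (X \<omega>)" and ?h = "\<lambda>\<omega>. h (X \<omega>) (U \<omega>)"
  show g_sq: "integrable M (\<lambda>\<omega>. (norm (?g \<omega>))\<^sup>2)"
  proof (rule Bochner_Integration.integrable_bound)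
    show "integrable M (\<lambda>\<omega>. 2 * L * (f (X \<omega>) - m))" using int by simp
    show "AE \<omega> in M. norm ((norm (?g \<omega>))\<^sup>2) \<le> norm (2 * L * (f (X \<omega>) - m))"
      using grad_norm_le_gap[OF diff Lip lower] by (intro AE_I2) (smt (verit) real_norm_def zero_le_power2)
  qed simp
  \<comment> \<open>By unbiasedness the squared mean subtracted in the variance is
    \<open>|grad f y|^2\<close>; moving it to the right turns \<open>V\<close> into
    \<open>V + 1\<close>.\<close>
  have h_second: "(\<integral>\<omega>. (norm (h y (U \<omega>)))\<^sup>2 \<partial>M) \<le> W + (V + 1) * (norm (grad f y))\<^sup>2" for y
    using h_var[of y] by (simp add: h_mean algebra_simps)
  let ?B = "\<lambda>\<omega>. W + (V + 1) * (norm (?g \<omega>))\<^sup>2"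
  \<comment> \<open>Integrability at the random point is still open here, so the second moment is
    first bounded as an extended nonnegative integral.\<close>
  have "(\<integral>\<^sup>+\<omega>. ennreal ((norm (?h \<omega>))\<^sup>2) \<partial>M)
      = (\<integral>\<^sup>+\<omega>. (\<integral>\<^sup>+\<omega>'. ennreal ((norm (h (X \<omega>) (U \<omega>')))\<^sup>2) \<partial>M) \<partial>M)"
    using nn_integral_indep_freeze[OF X U joint, of "\<lambda>(y, u). ennreal ((norm (h y u))\<^sup>2)"] by simp
  also have "\<dots> \<le> (\<integral>\<^sup>+\<omega>. ennreal (?B \<omega>) \<partial>M)"
    by (intro nn_integral_mono) (simp add: nn_integral_eq_integral[OF h_sq] h_second ennreal_leI)
  also have "\<dots> = ennreal (\<integral>\<omega>. ?B \<omega> \<partial>M)"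
    using g_sq WV by (intro nn_integral_eq_integral) auto
  finally have le: "(\<integral>\<^sup>+\<omega>. ennreal ((norm (?h \<omega>))\<^sup>2) \<partial>M) \<le> ennreal (\<integral>\<omega>. ?B \<omega> \<partial>M)" .
  have hh_sq: "integrable M (\<lambda>\<omega>. (norm (?h \<omega>))\<^sup>2)"
    using le by (intro integrableI_bounded) (auto simp: less_top[symmetric] top_unique)
  have "(\<integral>\<omega>. (norm (?h \<omega>))\<^sup>2 \<partial>M) \<le> (\<integral>\<omega>. ?B \<omega> \<partial>M)"
    using le WV by (simp add: nn_integral_eq_integral[OF hh_sq] ennreal_le_iff)
  also have "\<dots> = W + (V + 1) * (\<integral>\<omega>. (norm (?g \<omega>))\<^sup>2 \<partial>M)"
    using g_sq by (simp add: prob_space)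
  finally have hh_le: "(\<integral>\<omega>. (norm (?h \<omega>))\<^sup>2 \<partial>M) \<le> W + (V + 1) * (\<integral>\<omega>. (norm (?g \<omega>))\<^sup>2 \<partial>M)" .
  have gh_int: "integrable M (\<lambda>\<omega>. ?g \<omega> \<bullet> ?h \<omega>)"
  proof (rule Bochner_Integration.integrable_bound)
    show "integrable M (\<lambda>\<omega>. (norm (?g \<omega>))\<^sup>2 + (norm (?h \<omega>))\<^sup>2)" using g_sq hh_sq by simp
    have "\<bar>u \<bullet> v\<bar> \<le> (norm u)\<^sup>2 + (norm v)\<^sup>2" for u v :: 'b
      using Cauchy_Schwarz_ineq2[of u v] sum_squares_bound[of "norm u" "norm v"]
        mult_nonneg_nonneg[OF norm_ge_zero[of u] norm_ge_zero[of v]]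
      by linarith
    then show "AE \<omega> in M. norm (?g \<omega> \<bullet> ?h \<omega>) \<le> norm ((norm (?g \<omega>))\<^sup>2 + (norm (?h \<omega>))\<^sup>2)"
      by (intro AE_I2) auto
  qed simp
  \<comment> \<open>With \<open>X\<close> frozen, the estimator averages to \<open>grad f\<close>,
    so the cross term has the mean of the squared gradient norm.\<close>
  have gh: "(\<integral>\<omega>. ?g \<omega> \<bullet> ?h \<omega> \<partial>M) = (\<integral>\<omega>. (norm (?g \<omega>))\<^sup>2 \<partial>M)"
    using integral_indep_freeze[OF X U joint, of "\<lambda>(y, u). grad f y \<bullet> h y u"] gh_int
    by (simp add: h_int h_mean power2_norm_eq_inner)
  let ?Y = "\<lambda>\<omega>. X \<omega> - a *\<^sub>R ?h \<omega>"
  let ?Q = "\<lambda>\<omega>. f (X \<omega>) - a * (?g \<omega> \<bullet> ?h \<omega>) + L / 2 * a\<^sup>2 * (norm (?h \<omega>))\<^sup>2"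
  have Q: "f (?Y \<omega>) \<le> ?Q \<omega>" for \<omega>
    using descent_lemma[OF diff Lip(1), of "?Y \<omega>" "X \<omega>"] by (simp add: power_mult_distrib)
  have Q_int: "integrable M ?Q" using int gh_int hh_sq by simp
  \<comment> \<open>The value at the new point is squeezed between the constant \<open>m\<close> and
    the integrable majorant \<open>?Q\<close>.\<close>
  show ?int
  proof (rule Bochner_Integration.integrable_bound)
    show "integrable M (\<lambda>\<omega>. \<bar>m\<bar> + \<bar>?Q \<omega>\<bar>)" using Q_int by simp
    show "AE \<omega> in M. norm (f (?Y \<omega>)) \<le> norm (\<bar>m\<bar> + \<bar>?Q \<omega>\<bar>)"
      using Q lower by (intro AE_I2) (smt (verit) real_norm_def)
  qed simp
  then have "(\<integral>\<omega>. f (?Y \<omega>) \<partial>M) \<le> (\<integral>\<omega>. ?Q \<omega> \<partial>M)"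
    using Q_int Q by (rule integral_mono)
  also have "\<dots> = (\<integral>\<omega>. f (X \<omega>) \<partial>M) - a * (\<integral>\<omega>. (norm (?g \<omega>))\<^sup>2 \<partial>M)
      + L / 2 * a\<^sup>2 * (\<integral>\<omega>. (norm (?h \<omega>))\<^sup>2 \<partial>M)"
    using int gh_int hh_sq by (simp add: gh)
  also have "\<dots> \<le> (\<integral>\<omega>. f (X \<omega>) \<partial>M) - a * (\<integral>\<omega>. (norm (?g \<omega>))\<^sup>2 \<partial>M)
      + L / 2 * a\<^sup>2 * (W + (V + 1) * (\<integral>\<omega>. (norm (?g \<omega>))\<^sup>2 \<partial>M))"
    using hh_le Lip(2) by (intro add_left_mono mult_left_mono) auto
  also have "\<dots> \<le> (\<integral>\<omega>. f (X \<omega>) \<partial>M) - a / 2 * (\<integral>\<omega>. (norm (?g \<omega>))\<^sup>2 \<partial>M) + a\<^sup>2 * L * W / 2"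
  proof -
    \<comment> \<open>The step-size bound lets half of the descent term absorb the
      gradient-dependent part of the second moment.\<close>
    have "a / 2 * (\<integral>\<omega>. (norm (?g \<omega>))\<^sup>2 \<partial>M) * (a * L * (V + 1)) \<le> a / 2 * (\<integral>\<omega>. (norm (?g \<omega>))\<^sup>2 \<partial>M) * 1"
      using a by (intro mult_left_mono) auto
    then show ?thesis by (simp add: algebra_simps power2_eq_square)
  qed
  finally show ?bound .
qed

end

section \<open>The multilevel estimator\<close>

lemma ml_gradient_cong:
  assumes "\<And>j. j < N + M \<Longrightarrow> s j = t j"
  shows "ml_gradient RH RL N M s y = ml_gradient RH RL N M t y"
proof -
  have "restrict s {..<N} = restrict t {..<N}" "(\<lambda>j\<in>{..<M}. s (N + j)) = (\<lambda>j\<in>{..<M}. t (N + j))"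
    using assms by (auto simp: fun_eq_iff)
  then show ?thesis unfolding ml_gradient_def by simp
qed

text \<open>Both the point \<open>v\<close> and the draws \<open>w\<close> may depend on
  \<open>q\<close>, as happens for iterates, whose position is itself a function of earlier draws.
  Joint measurability of the estimators' gradients is composed with the pair of point and sample
  block.\<close>

lemma measurable_ml_gradient:
  assumes est: "gradient_estimator D RH" "gradient_estimator D RL"
    and "1 \<le> N" "1 \<le> M" and D: "sets D = sets S"
    and v: "v \<in> borel_measurable Q" and w: "\<And>j. j < N + M \<Longrightarrow> (\<lambda>q. w q j) \<in> measurable Q S"
  shows "(\<lambda>q. ml_gradient RH RL N M (w q) (v q)) \<in> borel_measurable Q"
proof -
  have wD: "(\<lambda>q. w q j) \<in> measurable Q D" if "j < N + M" for j
    using w[OF that] by (simp add: measurable_cong_sets[OF refl D])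
  have meas: "(\<lambda>q. grad (\<lambda>y. R n y (\<lambda>j\<in>{..<n}. w q (e j))) (v q)) \<in> borel_measurable Q"
    if R: "gradient_estimator D R" and n: "1 \<le> n" and e: "\<And>j. j < n \<Longrightarrow> e j < N + M" for R n e
  proof -
    have "(\<lambda>(x, s). grad (\<lambda>y. R n y s) x) \<in> borel_measurable (borel \<Otimes>\<^sub>M PiM {..<n} (\<lambda>_. D))"
      using R n unfolding gradient_estimator_def by blast
    moreover have "(\<lambda>q. (v q, \<lambda>j\<in>{..<n}. w q (e j))) \<in> measurable Q (borel \<Otimes>\<^sub>M PiM {..<n} (\<lambda>_. D))"
      using v e by (intro measurable_Pair measurable_restrict wD) auto
    ultimately show ?thesis
      by (auto dest: measurable_compose[rotated])
  qed
  show ?thesis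
    unfolding ml_gradient_def Let_def
    using meas[OF est(1), of N "\<lambda>j. j"] meas[OF est(2), of N "\<lambda>j. j"] meas[OF est(2), of M "\<lambda>j. N + j"] assms(3,4)
    by (intro borel_measurable_diff) (auto simp: restrict_def)
qed

section \<open>Laws of sample blocks and the mean of the multilevel gradient\<close>

context prob_space
begin

text \<open>Independence and the common law make the joint law of the whole family a product; its
  image under the injective reindexing \<open>e\<close> is the product over \<open>K\<close>. This
  handles the shared block and the shifted block alike.\<close>

lemma iid_block_law:
  assumes ind: "indep_vars (\<lambda>_. S) Y I" and law: "\<And>i. i \<in> I \<Longrightarrow> distr M S (Y i) = D"
    and D: "prob_space D" and e: "inj_on e K" "e ` K \<subseteq> I" and "K \<noteq> {}"
  shows "distr M (PiM K (\<lambda>_. D)) (\<lambda>\<omega>. \<lambda>k\<in>K. Y (e k) \<omega>) = PiM K (\<lambda>_. D)"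
proof -
  have I: "I \<noteq> {}" using e \<open>K \<noteq> {}\<close> by auto
  have rv: "random_variable S (Y i)" if "i \<in> I" for i
    using ind that unfolding indep_vars_def by blast
  have sets: "sets D = sets S" using law I by (metis ex_in_conv sets_distr)
  have rvD: "random_variable D (Y i)" if "i \<in> I" for i
    using rv[OF that] by (simp add: measurable_cong_sets[OF refl sets])
  have "distr M (PiM I (\<lambda>_. S)) (\<lambda>\<omega>. \<lambda>i\<in>I. Y i \<omega>) = PiM I (\<lambda>i. distr M S (Y i))"
    by (rule indep_vars_iff_distr_eq_PiM'[THEN iffD1, OF I rv ind])
  also have "\<dots> = PiM I (\<lambda>_. D)" using law by (intro PiM_cong) auto
  also have "distr M (PiM I (\<lambda>_. S)) (\<lambda>\<omega>. \<lambda>i\<in>I. Y i \<omega>) = distr M (PiM I (\<lambda>_. D)) (\<lambda>\<omega>. \<lambda>i\<in>I. Y i \<omega>)"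
    by (intro distr_cong sets_PiM_cong) (auto simp: sets)
  finally have joint: "distr M (PiM I (\<lambda>_. D)) (\<lambda>\<omega>. \<lambda>i\<in>I. Y i \<omega>) = PiM I (\<lambda>_. D)" .
  have "PiM K (\<lambda>_. D) = distr (PiM I (\<lambda>_. D)) (PiM K (\<lambda>_. D)) (\<lambda>z. \<lambda>k\<in>K. z (e k))"
    using e D by (intro distr_PiM_reindex[symmetric]) auto
  also have "\<dots> = distr M (PiM K (\<lambda>_. D)) ((\<lambda>z. \<lambda>k\<in>K. z (e k)) \<circ> (\<lambda>\<omega>. \<lambda>i\<in>I. Y i \<omega>))"
    using e rvD by (subst joint[symmetric], subst distr_distr) (auto intro!: measurable_restrict measurable_component_singleton)
  also have "(\<lambda>z. \<lambda>k\<in>K. z (e k)) \<circ> (\<lambda>\<omega>. \<lambda>i\<in>I. Y i \<omega>) = (\<lambda>\<omega>. \<lambda>k\<in>K. Y (e k) \<omega>)"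
    using e by (auto simp: fun_eq_iff)
  finally show ?thesis ..
qed

text \<open>Unbiasedness is stated for the product law on samples; a change of variables through the
  law of the block moves it to \<open>M\<close>.\<close>

lemma grad_iid_block:
  assumes ind: "indep_vars (\<lambda>_. S) Y I" and law: "\<And>i. i \<in> I \<Longrightarrow> distr M S (Y i) = D"
    and D: "prob_space D" and e: "inj_on e {..<n}" "e ` {..<n} \<subseteq> I" and n: "1 \<le> n"
    and unb: "unbiased_gradient D R f"
  shows "integrable M (\<lambda>\<omega>. grad (\<lambda>y. R n y (\<lambda>j\<in>{..<n}. Y (e j) \<omega>)) x)"
    and "(\<integral>\<omega>. grad (\<lambda>y. R n y (\<lambda>j\<in>{..<n}. Y (e j) \<omega>)) x \<partial>M) = grad f x"
proof -
  let ?V = "\<lambda>\<omega>. \<lambda>j\<in>{..<n}. Y (e j) \<omega>" and ?D = "PiM {..<n} (\<lambda>_. D)"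
  have ne: "{..<n} \<noteq> {}" using n by (simp add: lessThan_empty_iff)
  have I: "I \<noteq> {}" using e ne by auto
  have V_law: "distr M ?D ?V = ?D"
    by (rule iid_block_law[OF ind law D e ne])
  have sets: "sets D = sets S" using law I by (metis ex_in_conv sets_distr)
  have V: "random_variable ?D ?V"
  proof (rule measurable_restrict)
    fix j assume "j \<in> {..<n}"
    then have "random_variable S (Y (e j))" using ind e unfolding indep_vars_def by blast
    then show "random_variable D (Y (e j))" by (simp add: measurable_cong_sets[OF refl sets])
  qed
  have int: "integrable ?D (\<lambda>s. grad (\<lambda>y. R n y s) x)"
    and mean: "(\<integral>s. grad (\<lambda>y. R n y s) x \<partial>?D) = grad f x"
    using unb n unfolding unbiased_gradient_def by blast+
  have meas: "(\<lambda>s. grad (\<lambda>y. R n y s) x) \<in> borel_measurable ?D"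
    using int by (rule borel_measurable_integrable)
  show "integrable M (\<lambda>\<omega>. grad (\<lambda>y. R n y (?V \<omega>)) x)"
    using int integrable_distr_eq[OF V meas] by (simp add: V_law)
  show "(\<integral>\<omega>. grad (\<lambda>y. R n y (?V \<omega>)) x \<partial>M) = grad f x"
    using mean integral_distr[OF V meas] by (simp add: V_law)
qed

text \<open>By linearity each of the three terms contributes the mean over its own block, and the
  two low-fidelity means, both equal to \<open>grad g x\<close>, cancel.\<close>

lemma ml_gradient_mean:
  assumes ind: "indep_vars (\<lambda>_. S) Y I" and law: "\<And>i. i \<in> I \<Longrightarrow> distr M S (Y i) = D"
    and D: "prob_space D" and e: "inj_on e {..<n + m}" "e ` {..<n + m} \<subseteq> I" and nm: "1 \<le> n" "1 \<le> m"
    and unb: "unbiased_gradient D RH f" "unbiased_gradient D RL g"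
  shows "integrable M (\<lambda>\<omega>. ml_gradient RH RL n m (\<lambda>j. Y (e j) \<omega>) x)"
    and "(\<integral>\<omega>. ml_gradient RH RL n m (\<lambda>j. Y (e j) \<omega>) x \<partial>M) = grad f x"
proof -
  have e1: "inj_on e {..<n}" "e ` {..<n} \<subseteq> I"
    using e by (auto simp: inj_on_def image_subset_iff)
  have e2: "inj_on (\<lambda>j. e (n + j)) {..<m}" "(\<lambda>j. e (n + j)) ` {..<m} \<subseteq> I"
    using inj_on_eq_iff[OF e(1)] e(2) by (auto intro!: inj_onI simp: image_subset_iff)
  note H = grad_iid_block[OF ind law D e1 nm(1) unb(1)]
  note L = grad_iid_block[OF ind law D e1 nm(1) unb(2)]
  note L' = grad_iid_block[OF ind law D e2 nm(2) unb(2)]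
  show "integrable M (\<lambda>\<omega>. ml_gradient RH RL n m (\<lambda>j. Y (e j) \<omega>) x)"
    unfolding ml_gradient_def Let_def
    by (intro Bochner_Integration.integrable_diff H L L')
  show "(\<integral>\<omega>. ml_gradient RH RL n m (\<lambda>j. Y (e j) \<omega>) x \<partial>M) = grad f x"
    unfolding ml_gradient_def Let_def
    by (simp add: H L L' Bochner_Integration.integral_diff Bochner_Integration.integrable_diff)
qed

end

section \<open>The diminishing step-size recursion\<close>

text \<open>Write \<open>t = g + k\<close>. Since \<open>contr\<close> makes the factor of
  \<open>u k\<close> nonnegative, the induction hypothesis can be inserted; the bound on
  \<open>K\<close> then gives \<open>\<nu> (t - 1) / t^2\<close>, which is at most
  \<open>\<nu> / (t + 1)\<close> because \<open>(t - 1) (t + 1) \<le> t^2\<close>.\<close>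

lemma diminishing_step_recursion:
  fixes u :: "nat \<Rightarrow> real"
  assumes rec: "\<And>k. k \<ge> 1 \<Longrightarrow> u (Suc k) \<le> (1 - b * c / (g + real k)) * u k + (b / (g + real k))\<^sup>2 * K"
    and contr: "\<And>k. k \<ge> 1 \<Longrightarrow> b * c / (g + real k) \<le> 1"
    and g: "g > 0" and nu: "K \<le> (b * c - 1) * \<nu> / b\<^sup>2" "b > 0" "(g + 1) * u 1 \<le> \<nu>" "0 \<le> \<nu>"
  shows "k \<ge> 1 \<Longrightarrow> u k \<le> \<nu> / (g + real k)"
proof (induction k rule: nat_induct_at_least)
  case base
  then show ?case using g nu(3) by (simp add: field_simps)
next
  case (Suc k)
  let ?t = "g + real k"
  have t: "?t > 0" "?t > 1" using g Suc.hyps by auto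
  have "u (Suc k) \<le> (1 - b * c / ?t) * u k + (b / ?t)\<^sup>2 * K" by (rule rec) fact
  also have "\<dots> \<le> (1 - b * c / ?t) * (\<nu> / ?t) + (b / ?t)\<^sup>2 * ((b * c - 1) * \<nu> / b\<^sup>2)"
    using contr[OF Suc.hyps] Suc.IH nu(1) by (intro add_mono mult_left_mono) auto
  also have "\<dots> = \<nu> * ((?t - 1) / ?t\<^sup>2)"
  proof -
    have "(b / ?t)\<^sup>2 * ((b * c - 1) * \<nu> / b\<^sup>2) = (b * c - 1) * \<nu> / ?t\<^sup>2"
      using nu(2) by (simp add: power_divide)
    moreover have "(1 - b * c / ?t) * (\<nu> / ?t) = (?t - b * c) * \<nu> / ?t\<^sup>2"
      using t by (simp add: diff_divide_distrib power2_eq_square left_diff_distrib)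
    ultimately show ?thesis by (simp only: add_divide_distrib[symmetric] times_divide_eq_right) (simp add: algebra_simps)
  qed
  also have "\<dots> \<le> \<nu> * (1 / (?t + 1))"
  proof (intro mult_left_mono nu(4))
    have "(?t - 1) * (?t + 1) \<le> ?t\<^sup>2" by (simp add: algebra_simps power2_eq_square)
    with t show "(?t - 1) / ?t\<^sup>2 \<le> 1 / (?t + 1)"
      by (simp add: pos_divide_le_eq pos_le_divide_eq)
  qed
  finally show ?case by (simp add: algebra_simps)
qed

section \<open>Convergence rate of the multilevel stochastic gradient iteration\<close>

theorem theorem5p12:
  fixes P :: "'w measure" and \<Xi> :: "'s measure"
    and \<xi> :: "'w \<Rightarrow> 's"
    and J\<^sub>H J\<^sub>L :: "real ^ 'd \<Rightarrow> 's \<Rightarrow> real"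
    and Risk :: "('w \<Rightarrow> real) \<Rightarrow> real"
    and R\<^sub>H R\<^sub>L :: "real ^ 'd \<Rightarrow> real"
    and Rhat\<^sub>H Rhat\<^sub>L :: "nat \<Rightarrow> real ^ 'd \<Rightarrow> (nat \<Rightarrow> 's) \<Rightarrow> real"
    and N M :: nat
    and Z :: "nat \<Rightarrow> nat \<Rightarrow> 'w \<Rightarrow> 's"
    and G :: "nat \<Rightarrow> real ^ 'd \<Rightarrow> 'w \<Rightarrow> real ^ 'd"
    and x1 :: "real ^ 'd" and x :: "nat \<Rightarrow> 'w \<Rightarrow> real ^ 'd"
    and L\<^sub>H c\<^sub>H W\<^sub>M\<^sub>L W\<^sub>V \<beta> \<gamma> \<nu> Rstar :: real and \<alpha> :: "nat \<Rightarrow> real"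
  assumes P: "prob_space P"
    and \<xi>: "\<xi> \<in> measurable P \<Xi>"
    and J: "\<And>y. J\<^sub>H y \<in> borel_measurable \<Xi>" "\<And>y. J\<^sub>L y \<in> borel_measurable \<Xi>"
    and R\<^sub>H: "\<And>y. R\<^sub>H y = Risk (\<lambda>\<omega>. J\<^sub>H y (\<xi> \<omega>))"
    and R\<^sub>L: "\<And>y. R\<^sub>L y = Risk (\<lambda>\<omega>. J\<^sub>L y (\<xi> \<omega>))"
    and differentiable: "\<And>y. R\<^sub>H differentiable (at y)" "\<And>y. R\<^sub>L differentiable (at y)"
    and estimators: "gradient_estimator (distr P \<Xi> \<xi>) Rhat\<^sub>H"
      "gradient_estimator (distr P \<Xi> \<xi>) Rhat\<^sub>L"
    and unbiased: "unbiased_gradient (distr P \<Xi> \<xi>) Rhat\<^sub>H R\<^sub>H"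
      "unbiased_gradient (distr P \<Xi> \<xi>) Rhat\<^sub>L R\<^sub>L"
    and sizes: "1 \<le> N" "N < M"
    and indep: "prob_space.indep_vars P (\<lambda>_. \<Xi>) (\<lambda>(k, j). Z k j) ({1..} \<times> {..<N + M})"
    and ident: "\<And>k j. k \<ge> 1 \<Longrightarrow> j < N + M \<Longrightarrow> distr P \<Xi> (Z k j) = distr P \<Xi> \<xi>"
    and G: "\<And>k y \<omega>. G k y \<omega> = ml_gradient Rhat\<^sub>H Rhat\<^sub>L N M (\<lambda>j. Z k j \<omega>) y"
    and Lipschitz: "L\<^sub>H-lipschitz_on UNIV (grad R\<^sub>H)"
    and bounded_below: "bdd_below (range R\<^sub>H)" and Rstar: "Rstar = (INF y. R\<^sub>H y)"
    and strong_convexity: "c\<^sub>H > 0" "strongly_convex c\<^sub>H R\<^sub>H"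
    and W: "W\<^sub>M\<^sub>L \<ge> 0" "W\<^sub>V \<ge> 0"
    and second_moment: "\<And>k y. k \<ge> 1 \<Longrightarrow> integrable P (\<lambda>\<omega>. (norm (G k y \<omega>))\<^sup>2)"
    and variance: "\<And>k y. k \<ge> 1 \<Longrightarrow>
      (\<integral>\<omega>. (norm (G k y \<omega>))\<^sup>2 \<partial>P) - (norm (\<integral>\<omega>. G k y \<omega> \<partial>P))\<^sup>2
        \<le> W\<^sub>M\<^sub>L + W\<^sub>V * (norm (grad R\<^sub>H y))\<^sup>2"
    and start: "\<And>\<omega>. x 1 \<omega> = x1"
    and step: "\<And>k \<omega>. k \<ge> 1 \<Longrightarrow> x (Suc k) \<omega> = x k \<omega> - \<alpha> k *\<^sub>R G k (x k \<omega>) \<omega>"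
    and constants: "\<beta> > 1 / c\<^sub>H" "\<gamma> > 0"
    and rate: "\<And>k. k \<ge> 1 \<Longrightarrow> \<alpha> k = \<beta> / (\<gamma> + real k)"
      "\<And>k. k \<ge> 1 \<Longrightarrow> \<alpha> k \<le> 1 / (L\<^sub>H * (W\<^sub>V + 1))"
    and \<nu>: "\<nu> = max (\<beta>\<^sup>2 * L\<^sub>H * W\<^sub>M\<^sub>L / (2 * (\<beta> * c\<^sub>H - 1))) ((\<gamma> + 1) * (R\<^sub>H x1 - Rstar))"
  shows "\<forall>k\<ge>1. integrable P (\<lambda>\<omega>. R\<^sub>H (x k \<omega>) - Rstar) \<and>
    (\<integral>\<omega>. (R\<^sub>H (x k \<omega>) - Rstar) \<partial>P) \<le> \<nu> / (\<gamma> + real k)"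
proof -
  interpret prob_space P by (rule P)
  define D where "D = distr P \<Xi> \<xi>"
  define Y where "Y = (\<lambda>(k, j). Z k j)"
  \<comment> \<open>\<open>A k\<close> indexes the draws made before iteration \<open>k\<close>, and
    \<open>B k\<close> those of iteration \<open>k\<close> itself.\<close>
  define A where "A k = {1..<k} \<times> {..<N + M}" for k :: nat
  define B where "B k = {k} \<times> {..<N + M}" for k :: nat
  define U where "U k \<omega> = (\<lambda>i\<in>B k. Y i \<omega>)" for k \<omega>
  \<comment> \<open>\<open>h\<close> reads its draws from a function on index pairs, so it accepts
    \<open>U k\<close> as well as the restriction of \<open>Y\<close> to
    \<open>A (Suc k)\<close>.\<close>
  define h where "h k y z = ml_gradient Rhat\<^sub>H Rhat\<^sub>L N M (\<lambda>j. z (k, j)) y" for k :: nat and y and z :: "nat \<times> nat \<Rightarrow> 's"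
  have D: "prob_space D" unfolding D_def using \<xi> by (rule prob_space_distr)
  have sets_D: "sets D = sets \<Xi>" by (simp add: D_def)
  note est = estimators[folded D_def]
  have M1: "1 \<le> M" using sizes by simp
  have ind: "indep_vars (\<lambda>_. \<Xi>) Y ({1..} \<times> {..<N + M})"
    using indep unfolding Y_def .
  have law: "distr P \<Xi> (Y i) = D" if "i \<in> {1..} \<times> {..<N + M}" for i
    using that ident by (auto simp: Y_def D_def)
  have G_eq: "G k y \<omega> = h k y (U k \<omega>)" for k y \<omega>
    unfolding G h_def by (rule ml_gradient_cong) (simp add: U_def B_def Y_def)

  \<comment> \<open>Each iterate is a measurable function of past draws. \<open>A 1\<close> is
    empty, matching the deterministic start; the next iterate needs the old one, recovered by
    restriction, and the draws of iteration \<open>k\<close>, which lie in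
    \<open>A (Suc k)\<close>.\<close>
  have rep: "\<exists>\<phi>. \<phi> \<in> borel_measurable (PiM (A k) (\<lambda>_. \<Xi>)) \<and> (\<forall>\<omega>. x k \<omega> = \<phi> (\<lambda>i\<in>A k. Y i \<omega>))"
    if "k \<ge> 1" for k
    using that
  proof (induction k rule: nat_induct_at_least)
    case base
    show ?case by (rule exI[of _ "\<lambda>_. x1"]) (simp add: start[unfolded One_nat_def])
  next
    case (Suc k)
    then obtain \<phi> where \<phi>: "\<phi> \<in> borel_measurable (PiM (A k) (\<lambda>_. \<Xi>))"
      and x: "\<And>\<omega>. x k \<omega> = \<phi> (\<lambda>i\<in>A k. Y i \<omega>)" by blast
    have sub: "A k \<subseteq> A (Suc k)" and new: "\<And>j. j < N + M \<Longrightarrow> (k, j) \<in> A (Suc k)"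
      using Suc.hyps by (auto simp: A_def)
    let ?Q = "PiM (A (Suc k)) (\<lambda>_. \<Xi>)"
    have v: "(\<lambda>z. \<phi> (restrict z (A k))) \<in> borel_measurable ?Q"
      using measurable_restrict_subset[OF sub] \<phi> by (rule measurable_compose)
    have "(\<lambda>z. h k (\<phi> (restrict z (A k))) z) \<in> borel_measurable ?Q"
      unfolding h_def using new
      by (intro measurable_ml_gradient[OF est sizes(1) M1 sets_D v] measurable_component_singleton)
    with v have "(\<lambda>z. \<phi> (restrict z (A k)) - \<alpha> k *\<^sub>R h k (\<phi> (restrict z (A k))) z) \<in> borel_measurable ?Q"
      by simp
    moreover have "x (Suc k) \<omega> = \<phi> (restrict (\<lambda>i\<in>A (Suc k). Y i \<omega>) (A k))
        - \<alpha> k *\<^sub>R h k (\<phi> (restrict (\<lambda>i\<in>A (Suc k). Y i \<omega>) (A k))) (\<lambda>i\<in>A (Suc k). Y i \<omega>)" for \<omega>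
    proof -
      have "restrict (\<lambda>i\<in>A (Suc k). Y i \<omega>) (A k) = (\<lambda>i\<in>A k. Y i \<omega>)"
        using sub by (auto simp: fun_eq_iff)
      moreover have "G k y \<omega> = h k y (\<lambda>i\<in>A (Suc k). Y i \<omega>)" for y
        unfolding G h_def by (rule ml_gradient_cong) (simp add: new Y_def)
      ultimately show ?thesis using step[OF Suc.hyps] x by simp
    qed
    ultimately show ?case by (intro exI conjI allI)
  qed

  have x_U: "random_variable borel (x k)" "random_variable (PiM (B k) (\<lambda>_. \<Xi>)) (U k)"
    "distr P (borel \<Otimes>\<^sub>M PiM (B k) (\<lambda>_. \<Xi>)) (\<lambda>\<omega>. (x k \<omega>, U k \<omega>))
      = distr P borel (x k) \<Otimes>\<^sub>M distr P (PiM (B k) (\<lambda>_. \<Xi>)) (U k)" if k: "k \<ge> 1" for k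
  proof -
    let ?S = "PiM (A k) (\<lambda>_. \<Xi>)" and ?T = "PiM (B k) (\<lambda>_. \<Xi>)"
    let ?V = "\<lambda>\<omega>. \<lambda>i\<in>A k. Y i \<omega>"
    obtain \<phi> where \<phi>[measurable]: "\<phi> \<in> borel_measurable ?S"
      and x: "x k = (\<lambda>\<omega>. \<phi> (?V \<omega>))" using rep[OF k] by blast
    \<comment> \<open>Disjointness of \<open>A k\<close> and \<open>B k\<close> makes past and
      current draws independent. Mapping the first component by \<open>\<phi>\<close> and the second
      by the identity carries the product law over to \<open>x k\<close> and
      \<open>U k\<close>.\<close>
    have "indep_var ?S ?V ?T (U k)"
      unfolding U_def by (rule indep_var_restrict[OF ind]) (use k in \<open>auto simp: A_def B_def\<close>)
    then have V[measurable]: "random_variable ?S ?V" and U[measurable]: "random_variable ?T (U k)"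
      and VU: "distr P ?S ?V \<Otimes>\<^sub>M distr P ?T (U k) = distr P (?S \<Otimes>\<^sub>M ?T) (\<lambda>\<omega>. (?V \<omega>, U k \<omega>))"
      unfolding indep_var_distribution_eq by blast+
    show "random_variable borel (x k)" unfolding x by measurable
    show "random_variable ?T (U k)" by fact
    interpret U: prob_space "distr P ?T (U k)" by (rule prob_space_distr) fact
    have "distr P borel (x k) \<Otimes>\<^sub>M distr P ?T (U k)
        = distr (distr P ?S ?V) borel \<phi> \<Otimes>\<^sub>M distr (distr P ?T (U k)) ?T (\<lambda>u. u)"
      by (simp add: distr_distr x comp_def)
    also have "\<dots> = distr (distr P ?S ?V \<Otimes>\<^sub>M distr P ?T (U k)) (borel \<Otimes>\<^sub>M ?T) (\<lambda>(v, u). (\<phi> v, u))"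
      by (rule pair_measure_distr) (auto simp: distr_distr comp_def U.sigma_finite_measure_axioms)
    also have "\<dots> = distr P (borel \<Otimes>\<^sub>M ?T) (\<lambda>\<omega>. (x k \<omega>, U k \<omega>))"
      unfolding VU by (simp add: distr_distr x comp_def)
    finally show "distr P (borel \<Otimes>\<^sub>M ?T) (\<lambda>\<omega>. (x k \<omega>, U k \<omega>)) = distr P borel (x k) \<Otimes>\<^sub>M distr P ?T (U k)" ..
  qed

  \<comment> \<open>Measurability and mean of the gradient estimator in one iteration\<close>
  have h_meas: "(\<lambda>(y, z). h k y z) \<in> borel_measurable (borel \<Otimes>\<^sub>M PiM (B k) (\<lambda>_. \<Xi>))" for k
  proof -
    have "(\<lambda>q. ml_gradient Rhat\<^sub>H Rhat\<^sub>L N M (\<lambda>j. snd q (k, j)) (fst q))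
        \<in> borel_measurable (borel \<Otimes>\<^sub>M PiM (B k) (\<lambda>_. \<Xi>))"
    proof (rule measurable_ml_gradient[OF est sizes(1) M1 sets_D])
      fix j assume "j < N + M"
      then have "(\<lambda>z. z (k, j)) \<in> measurable (PiM (B k) (\<lambda>_. \<Xi>)) \<Xi>"
        by (intro measurable_component_singleton) (simp add: B_def)
      then show "(\<lambda>q. snd q (k, j)) \<in> measurable (borel \<Otimes>\<^sub>M PiM (B k) (\<lambda>_. \<Xi>)) \<Xi>"
        by (rule measurable_compose[OF measurable_snd])
    qed simp
    then show ?thesis by (simp add: h_def case_prod_beta')
  qed
  have h_mean: "integrable P (\<lambda>\<omega>. h k y (U k \<omega>))" "(\<integral>\<omega>. h k y (U k \<omega>) \<partial>P) = grad R\<^sub>H y"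
    if "k \<ge> 1" for k y
  proof -
    have e: "inj_on (Pair k) {..<N + M}" "Pair k ` {..<N + M} \<subseteq> {1..} \<times> {..<N + M}"
      using that by (auto simp: inj_on_def)
    have "h k y (U k \<omega>) = ml_gradient Rhat\<^sub>H Rhat\<^sub>L N M (\<lambda>j. Y (k, j) \<omega>) y" for \<omega>
      unfolding G_eq[symmetric] G by (simp add: Y_def)
    then show "integrable P (\<lambda>\<omega>. h k y (U k \<omega>))" "(\<integral>\<omega>. h k y (U k \<omega>) \<partial>P) = grad R\<^sub>H y"
      using ml_gradient_mean[OF ind law D e sizes(1) M1 unbiased[folded D_def]] by simp_all
  qed

  \<comment> \<open>Step-size constants and the one-step estimate along the iteration\<close>
  have "\<beta> > 0" using constants(1) strong_convexity(1) by (smt (verit) divide_pos_pos)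
  have \<alpha>_pos: "\<alpha> k > 0" if "k \<ge> 1" for k
    using rate(1)[OF that] \<open>\<beta> > 0\<close> constants(2) by simp
  have "L\<^sub>H > 0"
  proof -
    \<comment> \<open>Division by zero yields 0: for \<open>L\<^sub>H = 0\<close> the step-size
      bound would force \<open>\<alpha> 1 \<le> 0\<close>, against positivity of the step.\<close>
    have "L\<^sub>H \<noteq> 0" using rate(2)[of 1] \<alpha>_pos[of 1] by auto
    with lipschitz_on_nonneg[OF Lipschitz] show ?thesis by simp
  qed
  have \<alpha>_le: "\<alpha> k * L\<^sub>H * (W\<^sub>V + 1) \<le> 1" if "k \<ge> 1" for k
  proof -
    have "L\<^sub>H * (W\<^sub>V + 1) > 0" using \<open>L\<^sub>H > 0\<close> W by simp
    with rate(2)[OF that] show ?thesis by (simp add: pos_le_divide_eq mult.assoc)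
  qed
  have lower: "Rstar \<le> R\<^sub>H y" for y
    unfolding Rstar using bounded_below by (intro cINF_lower) auto
  have x_Suc: "x (Suc k) \<omega> = x k \<omega> - \<alpha> k *\<^sub>R h k (x k \<omega>) (U k \<omega>)" if "k \<ge> 1" for k \<omega>
    using step[OF that] by (simp add: G_eq)
  have sgd: "integrable P (\<lambda>\<omega>. R\<^sub>H (x (Suc k) \<omega>))"
    "integrable P (\<lambda>\<omega>. (norm (grad R\<^sub>H (x k \<omega>)))\<^sup>2)"
    "(\<integral>\<omega>. R\<^sub>H (x (Suc k) \<omega>) \<partial>P) \<le> (\<integral>\<omega>. R\<^sub>H (x k \<omega>) \<partial>P)
      - \<alpha> k / 2 * (\<integral>\<omega>. (norm (grad R\<^sub>H (x k \<omega>)))\<^sup>2 \<partial>P) + (\<alpha> k)\<^sup>2 * L\<^sub>H * W\<^sub>M\<^sub>L / 2"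
    if "k \<ge> 1" "integrable P (\<lambda>\<omega>. R\<^sub>H (x k \<omega>))" for k
    unfolding x_Suc[OF that(1)]
    using sgd_step[where h = "h k" and X = "x k" and U = "U k" and f = R\<^sub>H and a = "\<alpha> k" and V = W\<^sub>V and W = W\<^sub>M\<^sub>L,
        OF differentiable(1) Lipschitz \<open>L\<^sub>H > 0\<close> lower x_U[OF that(1)] h_meas h_mean[OF that(1)]
        second_moment[OF that(1), unfolded G_eq] variance[OF that(1), unfolded G_eq]
        less_imp_le[OF \<alpha>_pos[OF that(1)]] \<alpha>_le[OF that(1)] W that(2)]
    by simp_all
  \<comment> \<open>The one-step estimate presupposes integrability at the current iterate, so this
    is propagated from the deterministic start.\<close>
  have int: "integrable P (\<lambda>\<omega>. R\<^sub>H (x k \<omega>))" if "k \<ge> 1" for k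
    using that
  proof (induction k rule: nat_induct_at_least)
    case base
    show ?case by (simp add: start[unfolded One_nat_def])
  next
    case (Suc k)
    then show ?case by (intro sgd(1))
  qed

  \<comment> \<open>The recursion for the expected gap\<close>
  define u where "u k = (\<integral>\<omega>. (R\<^sub>H (x k \<omega>) - Rstar) \<partial>P)" for k
  have u: "u k = (\<integral>\<omega>. R\<^sub>H (x k \<omega>) \<partial>P) - Rstar" if "k \<ge> 1" for k
    using int[OF that] by (simp add: u_def prob_space)
  \<comment> \<open>The first entry of the maximum \<open>\<nu>\<close> is made for this: it lets
    the slack \<open>\<beta> * c\<^sub>H - 1\<close> pay for the noise.\<close>
  have \<nu>_ge: "L\<^sub>H * W\<^sub>M\<^sub>L / 2 \<le> (\<beta> * c\<^sub>H - 1) * \<nu> / \<beta>\<^sup>2"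
  proof -
    have "\<beta> * c\<^sub>H - 1 > 0" using constants(1) strong_convexity(1) by (simp add: field_simps)
    moreover have "\<beta>\<^sup>2 * L\<^sub>H * W\<^sub>M\<^sub>L / (2 * (\<beta> * c\<^sub>H - 1)) \<le> \<nu>" by (simp add: \<nu>)
    ultimately show ?thesis using \<open>\<beta> > 0\<close> by (simp add: field_simps)
  qed
  have "u k \<le> \<nu> / (\<gamma> + real k)" if "k \<ge> 1" for k
  proof (rule diminishing_step_recursion[OF _ _ constants(2) \<nu>_ge \<open>\<beta> > 0\<close> _ _ that])
    fix k :: nat assume k: "k \<ge> 1"
    \<comment> \<open>Chain: \<open>c\<^sub>H \<le> L\<^sub>H\<close>, then
      \<open>1 \<le> W\<^sub>V + 1\<close>, then the step-size bound.\<close>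
    have c: "\<alpha> k * c\<^sub>H \<le> 1"
    proof -
      have "\<alpha> k * c\<^sub>H \<le> \<alpha> k * L\<^sub>H"
        using strong_convexity_le_smoothness[OF differentiable(1) Lipschitz strong_convexity(2)] \<alpha>_pos[OF k]
        by simp
      also have "\<dots> \<le> \<alpha> k * L\<^sub>H * (W\<^sub>V + 1)"
        using \<alpha>_pos[OF k] \<open>L\<^sub>H > 0\<close> W by (simp add: algebra_simps)
      also have "\<dots> \<le> 1" by (rule \<alpha>_le[OF k])
      finally show ?thesis .
    qed
    then show "\<beta> * c\<^sub>H / (\<gamma> + real k) \<le> 1" using rate(1)[OF k] by simp
    let ?E = "\<integral>\<omega>. (norm (grad R\<^sub>H (x k \<omega>)))\<^sup>2 \<partial>P"
    \<comment> \<open>The Polyak-Lojasiewicz inequality holds pointwise and is integrated, which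
      turns the descent term into a contraction of \<open>u k\<close>.\<close>
    have "2 * c\<^sub>H * u k = (\<integral>\<omega>. 2 * c\<^sub>H * (R\<^sub>H (x k \<omega>) - Rstar) \<partial>P)" by (simp add: u_def)
    also have "\<dots> \<le> ?E"
    proof (rule integral_mono)
      show "integrable P (\<lambda>\<omega>. 2 * c\<^sub>H * (R\<^sub>H (x k \<omega>) - Rstar))" using int[OF k] by simp
      show "integrable P (\<lambda>\<omega>. (norm (grad R\<^sub>H (x k \<omega>)))\<^sup>2)" using k int by (intro sgd(2))
    qed (simp only: Rstar strongly_convex_gap_le[OF strong_convexity(2,1)])
    finally have PL: "\<alpha> k / 2 * (2 * c\<^sub>H * u k) \<le> \<alpha> k / 2 * ?E"
      using \<alpha>_pos[OF k] by (intro mult_left_mono) auto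
    have "u (Suc k) \<le> u k - \<alpha> k / 2 * ?E + (\<alpha> k)\<^sup>2 * L\<^sub>H * W\<^sub>M\<^sub>L / 2"
      using sgd(3)[OF k int[OF k]] k by (simp add: u)
    also have "\<dots> \<le> (1 - \<alpha> k * c\<^sub>H) * u k + (\<alpha> k)\<^sup>2 * (L\<^sub>H * W\<^sub>M\<^sub>L / 2)"
      using PL by (simp add: algebra_simps)
    finally show "u (Suc k) \<le> (1 - \<beta> * c\<^sub>H / (\<gamma> + real k)) * u k
        + (\<beta> / (\<gamma> + real k))\<^sup>2 * (L\<^sub>H * W\<^sub>M\<^sub>L / 2)"
      by (simp add: rate(1)[OF k])
  next
    \<comment> \<open>The second entry of the maximum starts the induction at \<open>k = 1\<close>;
      being nonnegative, it also gives \<open>0 \<le> \<nu>\<close>.\<close>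
    show "(\<gamma> + 1) * u 1 \<le> \<nu>" by (simp add: u_def start[unfolded One_nat_def] prob_space \<nu>)
    moreover have "0 \<le> (\<gamma> + 1) * (R\<^sub>H x1 - Rstar)" using constants(2) lower[of x1] by simp
    ultimately show "0 \<le> \<nu>" by (simp add: \<nu>)
  qed
  with int show ?thesis by (simp add: u_def)
qed

end
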